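(* Suppose $\mathfrak a$ and $\mathfrak b$ are primitive lists, with $\mathfrak b$ monotone, such that $s(\mathfrak a)$ and $s(\mathfrak b)$ are both non-zero and $\gcd(s(\mathfrak a),s(\mathfrak b))=1$. Suppose that $s(\mathfrak b)\,\mathfrak a+(-s(\mathfrak a))\,\mathfrak b$ is a list of height $D$ corresponding to an integral factorial ratio. Then every list of height $D+1$ that belongs to the family $$a\,\mathfrak a+b\,\mathfrak b+(-a\,s(\mathfrak a)-b\,s(\mathfrak b))\,[1]$$ (where $a,b$ are non-zero integers with $a\,s(\mathfrak a)+b\,s(\mathfrak b)\neq0$) corresponds to an integral factorial ratio.
   Context: A list $\mathfrak a=[a_1,\dots,a_n]$ is a finite multiset of non-zero integers (order is irrelevant, repetitions allowed), always assumed non-degenerate: it does not contain both $a$ and $-a$ for any $a$. Its sum is $s(\mathfrak a)=a_1+\dots+a_n$; its height $h(\mathfrak a)$ is the number of negative elements minus the number of positive elements (with multiplicity). A list is primitive if the gcd of its elements is $1$. For a non-zero integer $k$, $k\mathfrak a$ is the list obtained by multiplying every element by $k$. For lists $\mathfrak a_1,\mathfrak a_2$, the list $\mathfrak a_1+\mathfrak a_2$ is obtained by concatenating and then removing degeneracies, i.e. repeatedly deleting pairs $a,-a$. A list $\mathfrak a=[a_1,\dots,a_K,-b_1,\dots,-b_L]$ (with $a_i,b_j>0$) corresponds to an integral factorial ratio of height $D=L-K$ if $s(\mathfrak a)=0$ and $\frac{(a_1n)!\cdots(a_Kn)!}{(b_1n)!\cdots(b_Ln)!}$ is an integer for every natural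 number $n$. A list $\mathfrak b=[b_1,\dots,b_k]$ is monotone if the function of a real variable $x$ equal to $\sum_{i=1}^k\lfloor b_ix\rfloor$ when $b_ix\notin\mathbb Z$ for all $i$, and extended to all real $x$ by right continuity, is a monotone function of $x$ on $\mathbb R$. (It is then increasing if $s(\mathfrak b)>0$ and decreasing if $s(\mathfrak b)<0$.) *)

theory Defs
  imports Complex_Main "HOL-Library.Multiset"
begin

definition nondegenerate_list :: "int multiset \<Rightarrow> bool" where
  "nondegenerate_list A \<longleftrightarrow> 0 \<notin># A \<and> (\<forall>a. \<not> (a \<in># A \<and> - a \<in># A))"

definition list_height :: "int multiset \<Rightarrow> int" where
  "list_height A =
     int (size (filter_mset (\<lambda>a. a < 0) A)) - int (size (filter_mset (\<lambda>a. a > 0) A))"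

definition primitive_list :: "int multiset \<Rightarrow> bool" where
  "primitive_list A \<longleftrightarrow> Gcd (set_mset A) = 1"

definition list_scale :: "int \<Rightarrow> int multiset \<Rightarrow> int multiset" where
  "list_scale k A = image_mset (\<lambda>a. k * a) A"

text \<open>
  Multiset difference truncates, so an element \<open>a\<close> survives with multiplicity
  \<open>count A a - count A (- a)\<close>. Lemma \<open>cancel_pairs_iff\<close> below shows that this is the
  only possible final result of repeatedly deleting pairs \<open>a, - a\<close>.
\<close>
definition cancel_pairs :: "int multiset \<Rightarrow> int multiset" where
  "cancel_pairs A = A - image_mset uminus A"

definition list_add :: "int multiset \<Rightarrow> int multiset \<Rightarrow> int multiset" where
  "list_add A B = cancel_pairs (A + B)"

definition integral_factorial_ratio :: "int multiset \<Rightarrow> bool" where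
  "integral_factorial_ratio A \<longleftrightarrow>
     sum_mset A = 0 \<and>
     (\<forall>n::nat.
        (\<Prod>a\<in>#filter_mset (\<lambda>a. a > 0) A. fact (nat a * n)) /
        (\<Prod>b\<in>#filter_mset (\<lambda>b. b < 0) A. fact (nat (- b) * n)) \<in> (\<int> :: rat set))"

definition floor_sum :: "int multiset \<Rightarrow> real \<Rightarrow> real" where
  "floor_sum B x = of_int (\<Sum>b\<in>#B. \<lfloor>of_int b * x\<rfloor>)"

text \<open>
  The limit always exists and the resulting function is right continuous; see
  \<open>floor_sum_tendsto_right\<close> and \<open>right_cont_floor_sum_continuous\<close> below.
\<close>
definition right_cont_floor_sum :: "int multiset \<Rightarrow> real \<Rightarrow> real" where
  "right_cont_floor_sum B x =
     (if \<forall>b\<in>#B. of_int b * x \<notin> \<int> then floor_sum B x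
      else Lim (at_right x) (floor_sum B))"

definition monotone_list :: "int multiset \<Rightarrow> bool" where
  "monotone_list B \<longleftrightarrow> mono (right_cont_floor_sum B) \<or> antimono (right_cont_floor_sum B)"

inductive delete_pair :: "int multiset \<Rightarrow> int multiset \<Rightarrow> bool" where
  "delete_pair (A + {#a, - a#}) A"

lemma count_image_uminus: "count (image_mset uminus A) (a::int) = count A (- a)"
  by (induction A) auto

lemma cancel_pairs_iff:
  assumes "0 \<notin># A"
  shows "delete_pair\<^sup>*\<^sup>* A B \<and> nondegenerate_list B \<longleftrightarrow> B = cancel_pairs A"
proof -
  have nd: "nondegenerate_list (cancel_pairs C)" if "0 \<notin># C" for C
    using that unfolding nondegenerate_list_def cancel_pairs_def
    by (auto simp: in_diff_count count_image_uminus not_in_iff)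
  have id: "cancel_pairs C = C" if "nondegenerate_list C" for C
    unfolding cancel_pairs_def
  proof (rule multiset_eqI)
    fix a
    show "count (C - image_mset uminus C) a = count C a"
      using that unfolding nondegenerate_list_def
      by (cases "a \<in># C") (metis count_diff count_image_uminus diff_zero not_in_iff,
        simp add: not_in_iff)
  qed
  have step: "cancel_pairs C = cancel_pairs D" if "delete_pair C D" for C D
    using that
  proof cases
    case (1 a)
    show ?thesis
      unfolding cancel_pairs_def 1 by (rule multiset_eqI) (auto simp: count_image_uminus)
  qed
  have steps: "cancel_pairs C = cancel_pairs D" if "delete_pair\<^sup>*\<^sup>* C D" for C D
    using that by induction (auto dest: step)
  have ex: "delete_pair\<^sup>*\<^sup>* C (cancel_pairs C)" if "0 \<notin># C" for C
    using that
  proof (induction "size C" arbitrary: C rule: less_induct)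
    case less
    show ?case
    proof (cases "nondegenerate_list C")
      case True
      then show ?thesis by (simp add: id)
    next
      case False
      then obtain a where a: "a \<in># C" "- a \<in># C" "a \<noteq> 0"
        using less.prems unfolding nondegenerate_list_def by auto
      define D where "D = C - {#a, - a#}"
      have sub: "{#a, - a#} \<subseteq># C"
        using a by (auto simp: subseteq_mset_def Suc_le_eq)
      then have C: "C = D + {#a, - a#}"
        unfolding D_def by (rule subset_mset.diff_add[symmetric])
      then have d: "delete_pair C D"
        by (metis delete_pair.intros)
      have "size D < size C" "0 \<notin># D"
        using C less.prems by auto
      then have "delete_pair\<^sup>*\<^sup>* D (cancel_pairs D)"
        using less.hyps by blast
      then show ?thesis
        using d step[OF d] by (metis converse_rtranclp_into_rtranclp)
    qed
  qed
  show ?thesis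
    using steps id nd[OF assms] ex[OF assms] by metis
qed

lemma floor_sum_eventually_right:
  assumes "0 \<notin># B"
  shows "\<forall>\<^sub>F y in at_right x.
    (\<forall>b\<in>#B. of_int b * y \<notin> \<int>) \<and>
    floor_sum B y = of_int (\<Sum>b\<in>#B. if b > 0 then \<lfloor>of_int b * x\<rfloor> else \<lceil>of_int b * x\<rceil> - 1)"
  using assms
proof (induction B)
  case empty
  then show ?case by (simp add: floor_sum_def)
next
  case (add b B)
  have b: "b \<noteq> 0" using add.prems by auto
  define c where "c = (if b > 0 then \<lfloor>of_int b * x\<rfloor> else \<lceil>of_int b * x\<rceil> - 1)"
  have "\<forall>\<^sub>F y in at_right x. of_int c < of_int b * y \<and> of_int b * y < of_int c + 1"
  proof (cases "b > 0")
    case True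
    define u where "u = (of_int c + 1) / real_of_int b"
    have "x < u"
      using True unfolding u_def c_def by (simp add: field_simps) linarith
    then have "\<forall>\<^sub>F y in at_right x. x < y \<and> y < u"
      by (auto simp: eventually_at_right_field)
    then show ?thesis
    proof (rule eventually_mono)
      fix y assume y: "x < y \<and> y < u"
      have "of_int c \<le> of_int b * x" using True by (simp add: c_def)
      also have "\<dots> < of_int b * y" using True y by simp
      finally show "of_int c < of_int b * y \<and> of_int b * y < of_int c + 1"
        using y True by (simp add: u_def field_simps)
    qed
  next
    case False
    then have neg: "b < 0" using b by simp
    define u where "u = of_int c / real_of_int b"
    have "x < u"
      using neg unfolding u_def c_def by (simp add: field_simps) linarith
    then have "\<forall>\<^sub>F y in at_right x. x < y \<and> y < u"
      by (auto simp: eventually_at_right_field)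
    then show ?thesis
    proof (rule eventually_mono)
      fix y assume y: "x < y \<and> y < u"
      have "of_int b * y < of_int b * x" using neg y by simp
      also have "\<dots> \<le> of_int c + 1" using neg by (simp add: c_def)
      finally show "of_int c < of_int b * y \<and> of_int b * y < of_int c + 1"
        using y neg by (simp add: u_def field_simps)
    qed
  qed
  moreover have "\<forall>\<^sub>F y in at_right x.
    (\<forall>b\<in>#B. of_int b * y \<notin> \<int>) \<and>
    floor_sum B y = of_int (\<Sum>b\<in>#B. if b > 0 then \<lfloor>of_int b * x\<rfloor> else \<lceil>of_int b * x\<rceil> - 1)"
    using add by auto
  ultimately show ?case
  proof eventually_elim
    case (elim y)
    then have fl: "\<lfloor>of_int b * y\<rfloor> = c" by linarith
    have "of_int b * y \<notin> \<int>"
      using elim fl by (auto elim!: Ints_cases)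
    then show ?case
      using elim fl by (simp add: floor_sum_def flip: c_def)
  qed
qed

lemma floor_sum_tendsto_right:
  assumes "0 \<notin># B"
  shows "(floor_sum B \<longlongrightarrow> right_cont_floor_sum B x) (at_right x)"
proof -
  define c where
    "c = real_of_int (\<Sum>b\<in>#B. if b > 0 then \<lfloor>of_int b * x\<rfloor> else \<lceil>of_int b * x\<rceil> - 1)"
  have "\<forall>\<^sub>F y in at_right x. floor_sum B y = c"
    using floor_sum_eventually_right[OF assms, of x] unfolding c_def
    by (rule eventually_mono) blast
  then have lim: "(floor_sum B \<longlongrightarrow> c) (at_right x)"
    by (rule tendsto_eventually)
  have "right_cont_floor_sum B x = c"
  proof (cases "\<forall>b\<in>#B. of_int b * x \<notin> \<int>")
    case True
    have "floor_sum B x = c"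
      unfolding floor_sum_def c_def of_int_eq_iff
    proof (intro arg_cong[of _ _ sum_mset] image_mset_cong)
      fix b assume "b \<in># B"
      then have "of_int b * x \<notin> \<int>" using True by blast
      then show "\<lfloor>of_int b * x\<rfloor> = (if b > 0 then \<lfloor>of_int b * x\<rfloor> else \<lceil>of_int b * x\<rceil> - 1)"
        by (simp add: ceiling_altdef) (metis Ints_of_int)
    qed
    then show ?thesis using True by (simp add: right_cont_floor_sum_def)
  next
    case False
    have "Lim (at_right x) (floor_sum B) = c"
      using lim by (intro tendsto_Lim) auto
    then show ?thesis using False by (metis right_cont_floor_sum_def)
  qed
  then show ?thesis using lim by simp
qed

lemma right_cont_floor_sum_continuous:
  assumes "0 \<notin># B"
  shows "continuous (at_right x) (right_cont_floor_sum B)"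
proof -
  have "\<forall>\<^sub>F y in at_right x. floor_sum B y = right_cont_floor_sum B y"
    using floor_sum_eventually_right[OF assms, of x]
    by (rule eventually_mono) (simp add: right_cont_floor_sum_def)
  then have "(right_cont_floor_sum B \<longlongrightarrow> right_cont_floor_sum B x) (at_right x)"
    using floor_sum_tendsto_right[OF assms] by (rule Lim_transform_eventually[rotated])
  then show ?thesis by (simp add: continuous_within)
qed

end

theory Submission
  imports Defs "HOL-Computational_Algebra.Primes" "HOL-Analysis.Continuum_Not_Denumerable"
begin

text \<open>
  Write \<open>\<psi>(t) = {t} - 1/2\<close> and, for a list \<open>\<cc>\<close>, let \<open>\<Psi>\<^sub>\<cc>(x)\<close> be the sum of the \<open>\<psi>(c x)\<close> over
  its elements. Landau's criterion says that a list of sum zero is an integral factorial ratio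
  iff a certain step function, \<open>landau\<close> below, is nowhere negative; away from the rationals this
  step function is \<open>h/2 - \<Psi>\<^sub>\<cc>\<close>, where \<open>h\<close> is the height. So integrality means
  \<open>\<Psi>\<^sub>\<cc>(x) \<le> h/2\<close> for irrational \<open>x\<close>. The gain is that \<open>\<psi>\<close> is odd off the integers, so that
  \<open>\<Psi>\<close> does not see the removal of degeneracies and is additive in the list
  (lemmas \<open>integral_factorial_ratio_iff_sawtooth\<close> and \<open>sawtooth_sum_list_add\<close>).

  Let \<open>A = s(\<aa>)\<close> and \<open>B = s(\<bb>)\<close>. The hypothesis says that
  \<open>\<Psi>\<^sub>\<aa>(B z) + \<Psi>\<^sub>\<bb>(- A z) \<le> D/2\<close> for irrational \<open>z\<close>. As \<open>A\<close> and \<open>B\<close> are coprime, the points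
  \<open>(B z, - A z)\<close> fill, modulo 1, the whole set \<open>A u + B v \<in> \<int>\<close> of the torus
  (lemma \<open>one_parameter_subgroup_of_torus\<close>). Hence \<open>\<Psi>\<^sub>\<aa>(u) + \<Psi>\<^sub>\<bb>(v) \<le> D/2\<close> whenever
  \<open>u\<close> is irrational and \<open>A u + B v\<close> is an integer.

  For the conclusion, one has to show for \<open>u = a y\<close>, \<open>v = b y\<close> and \<open>w = A u + B v\<close> that
  \<open>\<Psi>\<^sub>\<aa>(u) + \<Psi>\<^sub>\<bb>(v) - \<psi>(w) \<le> (D + 1)/2\<close>. Put \<open>\<theta> = {w}\<close>. Moving \<open>v\<close> to \<open>v' = v - \<theta>/B\<close> turns \<open>w\<close>
  into an integer, so \<open>\<Psi>\<^sub>\<aa>(u) + \<Psi>\<^sub>\<bb>(v') \<le> D/2\<close>. Here \<open>\<Psi>\<^sub>\<bb>(v)\<close> is,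
  up to a constant, \<open>B v\<close> minus a step function that is monotone by assumption, with the direction given by the sign of \<open>B\<close>; therefore
  \<open>\<Psi>\<^sub>\<bb>(v) - \<Psi>\<^sub>\<bb>(v') \<le> \<theta>\<close> (lemma \<open>monotone_list_sawtooth_diff\<close>). The bound becomes
  \<open>D/2 + \<theta> - (\<theta> - 1/2) = (D + 1)/2\<close>.

  Irrational arguments keep all the products in question away from the integers, where the
  floors jump; the exceptional points are recovered from the right continuity of \<open>landau\<close>.
\<close>

section \<open>Landau's criterion\<close>

text \<open>
  The value at \<open>n / p ^ k\<close> is the contribution of \<open>p ^ k\<close> in Legendre's formula to the
  \<open>p\<close>-adic valuation of the factorial ratio at \<open>n\<close>. An element \<open>- b < 0\<close> enters as
  \<open>- \<lfloor>b x\<rfloor>\<close> rather than as \<open>\<lfloor>- b x\<rfloor>\<close>, which makes the function right continuous.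
\<close>

definition landau :: "int multiset \<Rightarrow> real \<Rightarrow> int" where
  "landau A x = (\<Sum>a\<in>#A. sgn a * \<lfloor>of_int \<bar>a\<bar> * x\<rfloor>)"

lemma multiplicity_eq_sum_dvd:
  fixes p m N :: nat
  assumes p: "prime p" and m: "0 < m" "m \<le> N"
  shows "multiplicity p m = (\<Sum>k=1..N. if p ^ k dvd m then 1 else 0)"
proof -
  have "multiplicity p m < p ^ multiplicity p m"
    using p by (intro power_gt_expt) (rule prime_gt_Suc_0_nat)
  also have "p ^ multiplicity p m \<le> m"
    using m by (intro dvd_imp_le multiplicity_dvd) auto
  finally have less: "multiplicity p m < m" .
  have dvd: "p ^ k dvd m \<longleftrightarrow> k \<le> multiplicity p m" for k
    using p m by (intro power_dvd_iff_le_multiplicity) auto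
  have "{k \<in> {1..N}. p ^ k dvd m} = {1..multiplicity p m}"
    unfolding dvd using less m(2) by (intro set_eqI) (simp, linarith)
  then show ?thesis
    by (simp add: sum.If_cases Int_def)
qed

text \<open>
  Legendre's formula: the factor \<open>m\<close> of \<open>n!\<close> contributes one for each \<open>k\<close> with
  \<open>p ^ k dvd m\<close>, and \<open>n div p ^ k\<close> of the factors are multiples of \<open>p ^ k\<close>.
\<close>

lemma multiplicity_fact_eq_sum_div:
  fixes p n N :: nat
  assumes p: "prime p" and "n \<le> N"
  shows "multiplicity p (fact n :: nat) = (\<Sum>k=1..N. n div p ^ k)"
  using \<open>n \<le> N\<close>
proof (induction n)
  case 0
  then show ?case by simp
next
  case (Suc n)
  have "multiplicity p (fact (Suc n) :: nat) = multiplicity p (Suc n) + multiplicity p (fact n :: nat)"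
    using p unfolding fact_Suc by (subst prime_elem_multiplicity_mult_distrib) auto
  also have "\<dots> = (\<Sum>k=1..N. (if p ^ k dvd Suc n then 1 else 0) + n div p ^ k)"
    using Suc p by (simp add: multiplicity_eq_sum_dvd sum.distrib)
  also have "\<dots> = (\<Sum>k=1..N. Suc n div p ^ k)"
    by (rule sum.cong) (auto simp: div_Suc dvd_eq_mod_eq_0)
  finally show ?case .
qed

lemma multiplicity_prod_fact:
  fixes M :: "int multiset" and f :: "int \<Rightarrow> nat"
  assumes p: "prime (p::nat)" and N: "\<And>a. a \<in># M \<Longrightarrow> f a \<le> N"
  shows "int (multiplicity p (\<Prod>a\<in>#M. fact (f a))) = (\<Sum>k=1..N. \<Sum>a\<in>#M. int (f a div p ^ k))"
  using N
proof (induction M)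
  case empty
  then show ?case by simp
next
  case (add a M)
  have "(\<Prod>a\<in>#M. fact (f a) :: nat) \<noteq> 0"
    by (auto simp: prod_mset_zero_iff)
  then have "multiplicity p (\<Prod>a\<in>#add_mset a M. fact (f a))
      = multiplicity p (fact (f a) :: nat) + multiplicity p (\<Prod>a\<in>#M. fact (f a))"
    using p by (simp add: prime_elem_multiplicity_mult_distrib)
  then show ?case
    using add p by (simp add: multiplicity_fact_eq_sum_div[of p _ N] sum.distrib)
qed

definition ratio_num :: "int multiset \<Rightarrow> nat \<Rightarrow> nat" where
  "ratio_num A n = (\<Prod>a\<in>#filter_mset (\<lambda>a. a > 0) A. fact (nat a * n))"

definition ratio_den :: "int multiset \<Rightarrow> nat \<Rightarrow> nat" where
  "ratio_den A n = (\<Prod>b\<in>#filter_mset (\<lambda>b. b < 0) A. fact (nat (- b) * n))"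

lemma integral_factorial_ratio_iff_dvd:
  "integral_factorial_ratio A \<longleftrightarrow> sum_mset A = 0 \<and> (\<forall>n. ratio_den A n dvd ratio_num A n)"
proof -
  have prod: "(\<Prod>a\<in>#M. fact (f a) :: rat) = of_nat (\<Prod>a\<in>#M. fact (f a))" for M :: "int multiset" and f
    by (induction M) auto
  have "of_nat x / of_nat y \<in> (\<int> :: rat set) \<longleftrightarrow> y dvd x" if "y \<noteq> 0" for x y :: nat
  proof
    assume "of_nat x / of_nat y \<in> (\<int> :: rat set)"
    then obtain z where "of_nat x / of_nat y = (of_int z :: rat)"
      by (auto elim: Ints_cases)
    then have "(of_int (int x) :: rat) = of_int (z * int y)"
      using that by (simp add: field_simps)
    then have "int y dvd int x"
      unfolding of_int_eq_iff by simp
    then show "y dvd x" by simp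
  next
    assume "y dvd x"
    then show "of_nat x / of_nat y \<in> (\<int> :: rat set)"
      using that by (auto elim!: dvdE)
  qed
  moreover have "ratio_den A n \<noteq> 0" for n
    by (auto simp: ratio_den_def prod_mset_zero_iff)
  ultimately show ?thesis
    unfolding integral_factorial_ratio_def prod ratio_num_def[symmetric] ratio_den_def[symmetric]
    by simp
qed

lemma landau_divide:
  "landau A (real n / real q) =
    (\<Sum>a\<in>#filter_mset (\<lambda>a. a > 0) A. int (nat a * n div q)) -
    (\<Sum>b\<in>#filter_mset (\<lambda>b. b < 0) A. int (nat (- b) * n div q))"
proof (induction A)
  case empty
  then show ?case by (simp add: landau_def)
next
  case (add a A)
  have "\<lfloor>real_of_int \<bar>a\<bar> * (real n / real q)\<rfloor> = int (nat \<bar>a\<bar> * n div q)"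
    using floor_divide_of_nat_eq[where ?'a = real, of "nat \<bar>a\<bar> * n" q] by simp
  with add show ?case
    by (cases "a > 0"; cases "a < 0") (auto simp: landau_def)
qed

lemma multiplicity_ratio:
  assumes p: "prime p" and N: "\<And>a. a \<in># A \<Longrightarrow> nat \<bar>a\<bar> * n \<le> N"
  shows "int (multiplicity p (ratio_num A n)) - int (multiplicity p (ratio_den A n)) =
    (\<Sum>k=1..N. landau A (real n / real (p ^ k)))"
proof -
  have "int (multiplicity p (ratio_num A n)) =
      (\<Sum>k=1..N. \<Sum>a\<in>#filter_mset (\<lambda>a. a > 0) A. int (nat a * n div p ^ k))"
    unfolding ratio_num_def using N by (intro multiplicity_prod_fact p) force
  moreover have "int (multiplicity p (ratio_den A n)) =
      (\<Sum>k=1..N. \<Sum>b\<in>#filter_mset (\<lambda>b. b < 0) A. int (nat (- b) * n div p ^ k))"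
    unfolding ratio_den_def using N by (intro multiplicity_prod_fact p) force
  ultimately show ?thesis
    by (simp only: landau_divide sum_subtractf)
qed

lemma landau_add_int: "landau A (x + of_int m) = landau A x + m * sum_mset A"
proof (induction A)
  case empty
  then show ?case by (simp add: landau_def)
next
  case (add a A)
  have "\<lfloor>real_of_int \<bar>a\<bar> * (x + of_int m)\<rfloor> = \<lfloor>real_of_int \<bar>a\<bar> * x\<rfloor> + \<bar>a\<bar> * m"
    by (simp add: distrib_left flip: of_int_mult of_int_abs)
  then have "sgn a * \<lfloor>real_of_int \<bar>a\<bar> * (x + of_int m)\<rfloor> = sgn a * \<lfloor>real_of_int \<bar>a\<bar> * x\<rfloor> + a * m"
    by (simp add: distrib_left mult.assoc[symmetric] sgn_mult_abs)
  with add show ?case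
    by (simp add: landau_def algebra_simps)
qed

lemma landau_right_constant: "\<exists>\<epsilon>>0. \<forall>y. x \<le> y \<and> y < x + \<epsilon> \<longrightarrow> landau A y = landau A x"
proof (induction A)
  case empty
  then show ?case by (auto simp: landau_def intro!: exI[of _ 1])
next
  case (add a A)
  then obtain \<epsilon> where \<epsilon>: "\<epsilon> > 0" "\<And>y. x \<le> y \<Longrightarrow> y < x + \<epsilon> \<Longrightarrow> landau A y = landau A x"
    by blast
  show ?case
  proof (cases "a = 0")
    case True
    then have "landau (add_mset a A) y = landau A y" for y by (simp add: landau_def)
    then show ?thesis using \<epsilon> by metis
  next
    case False
    define c where "c = real_of_int \<bar>a\<bar>"
    define \<delta> where "\<delta> = (of_int \<lfloor>c * x\<rfloor> + 1 - c * x) / c"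
    have c: "c > 0" using False by (simp add: c_def)
    have \<delta>: "\<delta> > 0" unfolding \<delta>_def using c by (intro divide_pos_pos) linarith+
    have floor: "\<lfloor>c * y\<rfloor> = \<lfloor>c * x\<rfloor>" if "x \<le> y" "y < x + \<delta>" for y
    proof -
      have "c * x \<le> c * y" using that c by simp
      moreover have "c * y < c * (x + \<delta>)" using that c by simp
      moreover have "c * (x + \<delta>) = of_int \<lfloor>c * x\<rfloor> + 1"
        using c by (simp add: \<delta>_def field_simps)
      ultimately show ?thesis by linarith
    qed
    have "landau (add_mset a A) y = landau (add_mset a A) x"
      if "x \<le> y" "y < x + min \<epsilon> \<delta>" for y
      using that \<epsilon>(2)[of y] floor[of y] by (simp add: landau_def c_def)
    moreover have "min \<epsilon> \<delta> > 0" using \<epsilon>(1) \<delta> by simp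
    ultimately show ?thesis by blast
  qed
qed

text \<open>
  By periodicity \<open>x\<close> may be taken in \<open>[0, 1)\<close>, which gives \<open>n \<le> p\<close> below.
  If the step function is negative at \<open>x\<close>, it is so on an interval to the right of \<open>x\<close>, which
  contains a fraction \<open>n/p\<close> for each large prime \<open>p\<close>. When \<open>p\<close> also exceeds the elements of the
  list, all floors at \<open>n/p\<^sup>2, n/p\<^sup>3, \<dots>\<close> vanish and Legendre's formula gives a negative
  \<open>p\<close>-adic valuation for the ratio at \<open>n\<close>.
\<close>

lemma integral_factorial_ratio_imp_landau_nonneg:
  assumes "integral_factorial_ratio A"
  shows "0 \<le> landau A x"
proof (rule ccontr)
  assume neg: "\<not> 0 \<le> landau A x"
  have sum: "sum_mset A = 0" and dvd: "ratio_den A n dvd ratio_num A n" for n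
    using assms by (auto simp: integral_factorial_ratio_iff_dvd)
  define t where "t = frac x"
  have t: "0 \<le> t" "t < 1" by (simp_all add: t_def frac_lt_1)
  have "landau A (t + of_int \<lfloor>x\<rfloor>) = landau A t"
    using sum by (simp add: landau_add_int)
  then have "landau A t < 0"
    using neg by (simp add: t_def frac_def)
  moreover obtain \<epsilon> where \<epsilon>: "\<epsilon> > 0" "\<And>y. t \<le> y \<Longrightarrow> y < t + \<epsilon> \<Longrightarrow> landau A y = landau A t"
    using landau_right_constant by blast
  ultimately have neg_right: "landau A y < 0" if "t \<le> y" "y < t + \<epsilon>" for y
    using that by metis
  define C where "C = Max (insert 0 ((\<lambda>a. nat \<bar>a\<bar>) ` set_mset A))"
  have C: "nat \<bar>a\<bar> \<le> C" if "a \<in># A" for a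
    using that unfolding C_def by (intro Max_ge) auto
  obtain p where p: "prime p" "C + nat \<lceil>1 / \<epsilon>\<rceil> < p"
    using bigger_prime by blast
  have p0: "real p > 0" using p by (simp add: prime_gt_0_nat)
  define n where "n = nat \<lceil>p * t\<rceil>"
  have n: "p * t \<le> n" "n < p * t + 1"
    using t p0 by (auto simp: n_def) linarith+
  have "p * t \<le> p" using t p0 by simp
  then have np: "n \<le> p" unfolding n_def by linarith
  have "1 / \<epsilon> < p" using p by linarith
  then have "1 / p < \<epsilon>" using \<epsilon> p0 by (simp add: field_simps)
  moreover have "t \<le> n / p" "n / p < t + 1 / p"
    using n p0 by (simp_all add: field_simps)
  ultimately have first: "landau A (n / p) < 0"
    by (intro neg_right) auto
  have later: "landau A (n / real (p ^ k)) = 0" if "2 \<le> k" for k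
  proof -
    have "\<lfloor>real_of_int \<bar>a\<bar> * (n / real (p ^ k))\<rfloor> = 0" if "a \<in># A" for a
    proof -
      have "nat \<bar>a\<bar> * n \<le> nat \<bar>a\<bar> * p"
        using np by (rule mult_le_mono2)
      also have "nat \<bar>a\<bar> * p < p * p"
        using C[OF that] p prime_gt_0_nat[OF p(1)] by simp
      also have "p * p \<le> p ^ k"
        using power_increasing[OF \<open>2 \<le> k\<close>, of p] prime_gt_0_nat[OF p(1)]
        by (simp add: power2_eq_square)
      finally have "nat \<bar>a\<bar> * n div p ^ k = 0" by simp
      then show ?thesis
        using floor_divide_of_nat_eq[where ?'a = real, of "nat \<bar>a\<bar> * n" "p ^ k"] by simp
    qed
    then show ?thesis
      unfolding landau_def by (intro sum_mset.neutral) auto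
  qed
  define N where "N = Suc (C * n)"
  have N: "nat \<bar>a\<bar> * n \<le> N" if "a \<in># A" for a
    using C[OF that] by (simp add: N_def le_SucI)
  have "multiplicity p (ratio_den A n) \<le> multiplicity p (ratio_num A n)"
    using dvd by (rule dvd_imp_multiplicity_le) (auto simp: ratio_num_def prod_mset_zero_iff)
  then have "0 \<le> (\<Sum>k=1..N. landau A (n / real (p ^ k)))"
    using multiplicity_ratio[OF p(1), of A n N] N by simp
  also have "{1..N} = insert 1 {2..N}"
    by (auto simp: N_def)
  also have "(\<Sum>k\<in>insert 1 {2..N}. landau A (n / real (p ^ k))) = landau A (n / p)"
    using later by simp
  finally show False using first by simp
qed

theorem integral_factorial_ratio_iff_landau:
  assumes "sum_mset A = 0"
  shows "integral_factorial_ratio A \<longleftrightarrow> (\<forall>x. 0 \<le> landau A x)"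
proof
  assume nonneg: "\<forall>x. 0 \<le> landau A x"
  have "ratio_den A n dvd ratio_num A n" for n
  proof (rule multiplicity_le_imp_dvd)
    show "ratio_den A n \<noteq> 0"
      by (auto simp: ratio_den_def prod_mset_zero_iff)
  next
    fix p :: nat
    assume p: "prime p"
    define N where "N = Max (insert 0 ((\<lambda>a. nat \<bar>a\<bar> * n) ` set_mset A))"
    have "nat \<bar>a\<bar> * n \<le> N" if "a \<in># A" for a
      using that unfolding N_def by (intro Max_ge) auto
    then have eq: "int (multiplicity p (ratio_num A n)) - int (multiplicity p (ratio_den A n)) =
        (\<Sum>k=1..N. landau A (n / real (p ^ k)))"
      by (rule multiplicity_ratio[OF p])
    have "(\<Sum>k=1..N. landau A (n / real (p ^ k))) \<ge> 0"
      using nonneg by (intro sum_nonneg) blast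
    with eq show "multiplicity p (ratio_den A n) \<le> multiplicity p (ratio_num A n)"
      by linarith
  qed
  with assms show "integral_factorial_ratio A"
    by (simp add: integral_factorial_ratio_iff_dvd)
qed (auto intro: integral_factorial_ratio_imp_landau_nonneg)

section \<open>The sawtooth sum of a list\<close>

lemma irrational_between:
  fixes x y :: real
  assumes "x < y"
  shows "\<exists>z. x < z \<and> z < y \<and> z \<notin> \<rat>"
proof -
  have "\<exists>z\<in>{x<..<y}. z \<notin> (\<rat> :: real set)"
    using assms by (intro open_minus_countable countable_rat) auto
  then show ?thesis by auto
qed

lemma of_int_mult_irrational:
  assumes "x \<notin> \<rat>" "a \<noteq> 0"
  shows "of_int a * (x::real) \<notin> \<rat>"
proof
  assume "of_int a * x \<in> \<rat>"
  then have "of_int a * x / of_int a \<in> \<rat>" by (intro Rats_divide) auto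
  with assms show False by simp
qed

lemma of_int_mult_irrational_not_Int:
  assumes "x \<notin> \<rat>" "a \<noteq> 0"
  shows "of_int a * (x::real) \<notin> \<int>"
  using of_int_mult_irrational[OF assms] Ints_subset_Rats by blast

definition sawtooth :: "real \<Rightarrow> real" where
  "sawtooth t = frac t - 1 / 2"

definition sawtooth_sum :: "int multiset \<Rightarrow> real \<Rightarrow> real" where
  "sawtooth_sum A x = (\<Sum>a\<in>#A. sawtooth (of_int a * x))"

text \<open>At an integer the two sides are \<open>- 1/2\<close> and \<open>1/2\<close>, so oddness fails there.\<close>

lemma sawtooth_minus: "t \<notin> \<int> \<Longrightarrow> sawtooth (- t) = - sawtooth t"
  by (simp add: sawtooth_def frac_neg)

lemma sawtooth_sum_add: "sawtooth_sum (A + B) x = sawtooth_sum A x + sawtooth_sum B x"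
  by (simp add: sawtooth_sum_def)

lemma sawtooth_sum_list_scale: "sawtooth_sum (list_scale k A) x = sawtooth_sum A (of_int k * x)"
  by (simp add: sawtooth_sum_def list_scale_def image_mset.compositionality comp_def mult_ac)

lemma sawtooth_sum_add_int: "sawtooth_sum A (x + of_int m) = sawtooth_sum A x"
proof -
  have "sawtooth (of_int a * (x + of_int m)) = sawtooth (of_int a * x)" for a
    by (simp add: sawtooth_def frac_def distrib_left flip: of_int_mult)
  then show ?thesis by (simp add: sawtooth_sum_def)
qed

lemma sum_mset_cancel_pairs:
  fixes f :: "int \<Rightarrow> 'a::ab_group_add"
  assumes "0 \<notin># A" and odd: "\<And>a. a \<noteq> 0 \<Longrightarrow> f (- a) = - f a"
  shows "(\<Sum>a\<in>#cancel_pairs A. f a) = (\<Sum>a\<in>#A. f a)"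
proof -
  obtain B where B: "B = cancel_pairs A" and "delete_pair\<^sup>*\<^sup>* A B"
    using cancel_pairs_iff[OF assms(1)] by blast
  from this(2) show ?thesis
    unfolding B[symmetric] using assms(1)
  proof (induction rule: converse_rtranclp_induct)
    case (step C E)
    from step.hyps(1) obtain a where C: "C = E + {#a, - a#}"
      by cases
    then have "a \<noteq> 0" "0 \<notin># E" using step.prems by auto
    with step.IH odd show ?case by (simp add: C)
  qed simp
qed

lemma zero_notin_list_add:
  assumes "0 \<notin># A" "0 \<notin># B"
  shows "0 \<notin># list_add A B"
  using assms unfolding list_add_def cancel_pairs_def by (auto dest: in_diffD)

lemma sum_mset_list_add:
  assumes "0 \<notin># A" "0 \<notin># B"
  shows "sum_mset (list_add A B) = sum_mset A + sum_mset B"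
  using sum_mset_cancel_pairs[of "A + B" "\<lambda>a. a"] assms by (simp add: list_add_def)

lemma sawtooth_sum_list_add:
  assumes "0 \<notin># A" "0 \<notin># B" "x \<notin> \<rat>"
  shows "sawtooth_sum (list_add A B) x = sawtooth_sum A x + sawtooth_sum B x"
proof -
  have "sawtooth (of_int (- a) * x) = - sawtooth (of_int a * x)" if "a \<noteq> 0" for a
    using sawtooth_minus[OF of_int_mult_irrational_not_Int[OF assms(3) that]] by simp
  then have "sawtooth_sum (list_add A B) x = sawtooth_sum (A + B) x"
    unfolding sawtooth_sum_def list_add_def using assms by (intro sum_mset_cancel_pairs) auto
  then show ?thesis by (simp add: sawtooth_sum_add)
qed

lemma zero_notin_list_scale: "k \<noteq> 0 \<Longrightarrow> 0 \<notin># A \<Longrightarrow> 0 \<notin># list_scale k A"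
  by (auto simp: list_scale_def)

lemma sum_mset_list_scale: "sum_mset (list_scale k A) = k * sum_mset A"
  by (induction A) (auto simp: list_scale_def algebra_simps)

lemma landau_eq_sawtooth_sum:
  assumes "0 \<notin># A" "x \<notin> \<rat>"
  shows "of_int (landau A x) = of_int (sum_mset A) * x + of_int (list_height A) / 2 - sawtooth_sum A x"
  using assms(1)
proof (induction A)
  case empty
  then show ?case by (simp add: landau_def list_height_def sawtooth_sum_def)
next
  case (add a A)
  then have a: "a \<noteq> 0" by auto
  have "real_of_int (landau (add_mset a A) x) = of_int (sgn a * \<lfloor>of_int \<bar>a\<bar> * x\<rfloor>) + of_int (landau A x)"
    by (simp add: landau_def)
  moreover have "real_of_int (sgn a * \<lfloor>of_int \<bar>a\<bar> * x\<rfloor>) = of_int a * x - of_int (sgn a) / 2 - sawtooth (of_int a * x)"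
  proof (cases "a > 0")
    case True
    then show ?thesis by (simp add: sawtooth_def frac_def)
  next
    case False
    then have "a < 0" using a by simp
    then show ?thesis
      using sawtooth_minus[OF of_int_mult_irrational_not_Int[OF assms(2) a]]
      by (simp add: sawtooth_def frac_def)
  qed
  moreover have "list_height (add_mset a A) = list_height A - sgn a"
    using a by (simp add: list_height_def sgn_if)
  moreover have "sawtooth_sum (add_mset a A) x = sawtooth (of_int a * x) + sawtooth_sum A x"
    by (simp add: sawtooth_sum_def)
  ultimately show ?case
    using add by (simp add: field_simps)
qed

lemma integral_factorial_ratio_iff_sawtooth:
  assumes "0 \<notin># A" "sum_mset A = 0"
  shows "integral_factorial_ratio A \<longleftrightarrow>
    (\<forall>x. x \<notin> \<rat> \<longrightarrow> sawtooth_sum A x \<le> of_int (list_height A) / 2)"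
proof -
  have irr: "0 \<le> landau A x \<longleftrightarrow> sawtooth_sum A x \<le> of_int (list_height A) / 2" if "x \<notin> \<rat>" for x
    using landau_eq_sawtooth_sum[OF assms(1) that] assms(2) by (simp flip: of_int_0_le_iff[where ?'a = real])
  have "0 \<le> landau A x" if "\<forall>y. y \<notin> \<rat> \<longrightarrow> 0 \<le> landau A y" for x
  proof -
    obtain \<epsilon> where "\<epsilon> > 0" "\<And>y. x \<le> y \<Longrightarrow> y < x + \<epsilon> \<Longrightarrow> landau A y = landau A x"
      using landau_right_constant by blast
    moreover from \<open>\<epsilon> > 0\<close> obtain y where "x < y" "y < x + \<epsilon>" "y \<notin> \<rat>"
      using irrational_between[of x "x + \<epsilon>"] by auto
    ultimately show ?thesis using that by (metis less_imp_le)
  qed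
  with irr show ?thesis
    unfolding integral_factorial_ratio_iff_landau[OF assms(2)] by blast
qed

section \<open>Monotone lists\<close>

lemma right_cont_floor_sum_eq_sawtooth_sum:
  assumes "0 \<notin># B" "x \<notin> \<rat>"
  shows "right_cont_floor_sum B x = of_int (sum_mset B) * x - sawtooth_sum B x - of_nat (size B) / 2"
proof -
  have "\<forall>b\<in>#B. of_int b * x \<notin> \<int>"
    using assms by (metis of_int_mult_irrational_not_Int)
  then have "right_cont_floor_sum B x = floor_sum B x"
    by (simp add: right_cont_floor_sum_def)
  also have "\<dots> = of_int (sum_mset B) * x - sawtooth_sum B x - of_nat (size B) / 2"
    by (induction B) (auto simp: floor_sum_def sawtooth_sum_def sawtooth_def frac_def field_simps)
  finally show ?thesis .
qed

text \<open>
  Up to a constant, \<open>\<Psi>\<close> is the linear function with slope \<open>s\<close>, the sum of the list, minus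
  the step function \<open>g\<close> that is assumed to be monotone. Since \<open>g(x + 1) = g(x) + s\<close>, the
  sign of \<open>s\<close> decides whether \<open>g\<close> increases or decreases. In both cases, moving from
  \<open>v - \<theta>/s\<close> to \<open>v\<close> increases the linear part by \<open>\<theta>\<close> and does not decrease \<open>g\<close>.
\<close>

lemma monotone_list_sawtooth_diff:
  assumes "0 \<notin># B" "monotone_list B" "sum_mset B \<noteq> 0" "0 \<le> \<theta>"
    and v: "v \<notin> \<rat>" "v - \<theta> / of_int (sum_mset B) \<notin> \<rat>"
  shows "sawtooth_sum B v - sawtooth_sum B (v - \<theta> / of_int (sum_mset B)) \<le> \<theta>"
proof -
  define s where "s = real_of_int (sum_mset B)"
  define g where "g = right_cont_floor_sum B"
  have s: "s \<noteq> 0" using assms by (simp add: s_def)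
  have g: "g x = s * x - sawtooth_sum B x - of_nat (size B) / 2" if "x \<notin> \<rat>" for x
    unfolding g_def s_def using assms(1) that by (rule right_cont_floor_sum_eq_sawtooth_sum)
  have v1: "v + 1 \<notin> \<rat>"
    using v(1) Rats_diff[of "v + 1" 1] by auto
  have step: "g (v + 1) = g v + s"
    using g[OF v(1)] g[OF v1] sawtooth_sum_add_int[of B v 1] by (simp add: algebra_simps)
  have "g (v - \<theta> / s) \<le> g v"
    using assms(2) unfolding monotone_list_def g_def[symmetric]
  proof
    assume "mono g"
    then have "s > 0" using step s monoD[of g v "v + 1"] by simp
    then show ?thesis using \<open>mono g\<close> assms(4) by (simp add: monoD)
  next
    assume "antimono g"
    then have "s < 0" using step s antimonoD[of g v "v + 1"] by simp
    then show ?thesis using \<open>antimono g\<close> assms(4) by (intro antimonoD[of g]) (simp_all add: divide_le_0_iff)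
  qed
  moreover have "s * (v - \<theta> / s) = s * v - \<theta>"
    using s by (simp add: right_diff_distrib)
  ultimately show ?thesis
    using g[OF v(1)] g v(2) by (simp add: s_def)
qed

section \<open>Lifting from a ratio to the two-parameter family\<close>

text \<open>
  The candidates for \<open>z\<close> are the numbers \<open>(u + j) / B\<close>, and \<open>- A z\<close> is then \<open>v\<close> modulo 1 iff
  \<open>B\<close> divides \<open>m + A j\<close>. Coprimality makes this congruence for \<open>j\<close> solvable.
\<close>

lemma one_parameter_subgroup_of_torus:
  fixes A B m :: int and u v :: real
  assumes "gcd A B = 1" "B \<noteq> 0" "of_int A * u + of_int B * v = of_int m"
  shows "\<exists>z j l. of_int B * z = u + of_int j \<and> - of_int A * z = v + of_int l"
proof -
  obtain r s where rs: "r * A + s * B = 1"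
    using bezout_int[of A B] assms(1) by auto
  define j where "j = - m * r"
  define z where "z = (u + of_int j) / of_int B"
  have 1: "of_int B * z = u + of_int j"
    using assms(2) by (simp add: z_def)
  have "real_of_int r * of_int A + of_int s * of_int B = 1"
    using arg_cong[OF rs, of real_of_int] by simp
  then have "of_int B * (- of_int A * z) = of_int B * (v + of_int (- m * s))"
    using 1 assms(3) by (simp add: j_def) algebra
  then have "- of_int A * z = v + of_int (- m * s)"
    using assms(2) by (subst (asm) mult_left_cancel) auto
  with 1 show ?thesis by blast
qed

lemma sawtooth_sum_bound_on_torus:
  assumes "0 \<notin># \<aa>" "0 \<notin># \<bb>" "sum_mset \<aa> \<noteq> 0" "sum_mset \<bb> \<noteq> 0"
    and "gcd (sum_mset \<aa>) (sum_mset \<bb>) = 1"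
    and ratio: "integral_factorial_ratio
           (list_add (list_scale (sum_mset \<bb>) \<aa>) (list_scale (- sum_mset \<aa>) \<bb>))"
    and "u \<notin> \<rat>" and "of_int (sum_mset \<aa>) * u + of_int (sum_mset \<bb>) * v \<in> \<int>"
  shows "sawtooth_sum \<aa> u + sawtooth_sum \<bb> v \<le>
    of_int (list_height (list_add (list_scale (sum_mset \<bb>) \<aa>) (list_scale (- sum_mset \<aa>) \<bb>))) / 2"
proof -
  define A B where "A = sum_mset \<aa>" and "B = sum_mset \<bb>"
  let ?L = "list_scale B \<aa>" and ?R = "list_scale (- A) \<bb>"
  have zero: "0 \<notin># ?L" "0 \<notin># ?R"
    using assms(1-4) by (simp_all add: A_def B_def zero_notin_list_scale)
  obtain m where m: "of_int A * u + of_int B * v = of_int m"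
    using assms(8) unfolding A_def B_def by (elim Ints_cases)
  obtain z j l where z: "of_int B * z = u + of_int j" "- of_int A * z = v + of_int l"
    using one_parameter_subgroup_of_torus[OF _ _ m] assms(4,5) by (auto simp: A_def B_def)
  have "z \<notin> \<rat>"
  proof
    assume "z \<in> \<rat>"
    then have "of_int B * z - of_int j \<in> \<rat>" by simp
    with z(1) assms(7) show False by simp
  qed
  then have "sawtooth_sum (list_add ?L ?R) z \<le> of_int (list_height (list_add ?L ?R)) / 2"
    using ratio integral_factorial_ratio_iff_sawtooth[OF zero_notin_list_add[OF zero]]
    by (auto simp: A_def B_def integral_factorial_ratio_def)
  also have "sawtooth_sum (list_add ?L ?R) z = sawtooth_sum \<aa> u + sawtooth_sum \<bb> v"
    using sawtooth_sum_list_add[OF zero \<open>z \<notin> \<rat>\<close>] z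
    by (simp add: sawtooth_sum_list_scale sawtooth_sum_add_int)
  finally show ?thesis by (simp add: A_def B_def)
qed

theorem theorem1p4:
  fixes \<aa> \<bb> :: "int multiset" and D :: int
  assumes "nondegenerate_list \<aa>" and "nondegenerate_list \<bb>"
    and "primitive_list \<aa>" and "primitive_list \<bb>"
    and "monotone_list \<bb>"
    and "sum_mset \<aa> \<noteq> 0" and "sum_mset \<bb> \<noteq> 0"
    and "gcd (sum_mset \<aa>) (sum_mset \<bb>) = 1"
    and "list_height (list_add (list_scale (sum_mset \<bb>) \<aa>) (list_scale (- sum_mset \<aa>) \<bb>)) = D"
    and "integral_factorial_ratio
           (list_add (list_scale (sum_mset \<bb>) \<aa>) (list_scale (- sum_mset \<aa>) \<bb>))"
  shows "\<forall>a b :: int. \<forall>\<cc>.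
    a \<noteq> 0 \<and> b \<noteq> 0 \<and> a * sum_mset \<aa> + b * sum_mset \<bb> \<noteq> 0 \<and>
    \<cc> = list_add (list_add (list_scale a \<aa>) (list_scale b \<bb>))
          (list_scale (- a * sum_mset \<aa> - b * sum_mset \<bb>) {#1#}) \<and>
    list_height \<cc> = D + 1 \<longrightarrow>
    integral_factorial_ratio \<cc>"
proof (intro allI impI, elim conjE)
  fix a b :: int and \<cc>
  define A B where "A = sum_mset \<aa>" and "B = sum_mset \<bb>"
  define e where "e = - a * A - b * B"
  assume "a \<noteq> 0" "b \<noteq> 0" and ne: "a * sum_mset \<aa> + b * sum_mset \<bb> \<noteq> 0"
    and \<cc>: "\<cc> = list_add (list_add (list_scale a \<aa>) (list_scale b \<bb>))
          (list_scale (- a * sum_mset \<aa> - b * sum_mset \<bb>) {#1#})"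
    and height: "list_height \<cc> = D + 1"
  have A: "A \<noteq> 0" and B: "B \<noteq> 0" and e: "e \<noteq> 0"
    using assms ne by (auto simp: A_def B_def e_def)
  have zero: "0 \<notin># \<aa>" "0 \<notin># \<bb>"
    using assms by (auto simp: nondegenerate_list_def)
  have zero': "0 \<notin># list_scale a \<aa>" "0 \<notin># list_scale b \<bb>" "0 \<notin># list_scale e {#1#}"
    using zero \<open>a \<noteq> 0\<close> \<open>b \<noteq> 0\<close> e by (simp_all add: zero_notin_list_scale)
  note zero'' = zero_notin_list_add[OF zero'(1,2)]
  have \<cc>': "\<cc> = list_add (list_add (list_scale a \<aa>) (list_scale b \<bb>)) (list_scale e {#1#})"
    using \<cc> by (simp add: A_def B_def e_def)
  have "0 \<notin># \<cc>"
    unfolding \<cc>' using zero'' zero'(3) by (rule zero_notin_list_add)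
  moreover have "sum_mset \<cc> = 0"
    unfolding \<cc>' sum_mset_list_add[OF zero'' zero'(3)] sum_mset_list_add[OF zero'(1,2)]
    by (simp add: sum_mset_list_scale A_def B_def e_def)
  moreover have "sawtooth_sum \<cc> y \<le> of_int (list_height \<cc>) / 2" if y: "y \<notin> \<rat>" for y
  proof -
    define u v w where "u = of_int a * y" and "v = of_int b * y" and "w = of_int A * u + of_int B * v"
    define \<theta> where "\<theta> = frac w"
    \<comment> \<open>The shift that makes \<open>A u + B v'\<close> the integer \<open>\<lfloor>w\<rfloor>\<close>.\<close>
    define v' where "v' = v - \<theta> / of_int B"
    have irr: "u \<notin> \<rat>" "v \<notin> \<rat>"
      using y \<open>a \<noteq> 0\<close> \<open>b \<noteq> 0\<close> by (auto simp: u_def v_def dest: of_int_mult_irrational)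
    have w: "w = - (of_int e * y)"
      by (simp add: w_def u_def v_def e_def algebra_simps)
    have "of_int e * y \<notin> \<int>"
      using of_int_mult_irrational_not_Int[OF y e] .
    then have saw_e: "sawtooth (of_int e * y) = 1 / 2 - \<theta>"
      using sawtooth_minus[of "of_int e * y"] by (simp add: \<theta>_def w sawtooth_def)
    have "of_int B * v' = of_int B * v - \<theta>"
      using B by (simp add: v'_def right_diff_distrib)
    then have v': "of_int A * u + of_int B * v' = of_int \<lfloor>w\<rfloor>"
      by (simp add: \<theta>_def frac_def) (simp add: w_def)
    have "v' \<notin> \<rat>"
    proof
      assume "v' \<in> \<rat>"
      then have "of_int \<lfloor>w\<rfloor> - of_int B * v' \<in> \<rat>" by simp
      also have "of_int \<lfloor>w\<rfloor> - of_int B * v' = of_int A * u" using v' by linarith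
      finally have "of_int A * u \<in> \<rat>" .
      then show False using of_int_mult_irrational[OF irr(1) A] by simp
    qed
    then have "sawtooth_sum \<bb> v - sawtooth_sum \<bb> v' \<le> \<theta>"
      using monotone_list_sawtooth_diff[of \<bb> \<theta> v] zero assms(5,7) irr
      by (simp add: v'_def B_def \<theta>_def)
    moreover have "sawtooth_sum \<aa> u + sawtooth_sum \<bb> v' \<le> of_int D / 2"
      using sawtooth_sum_bound_on_torus[OF zero assms(6,7,8,10) irr(1), of v'] v' assms(9)
      by (simp add: A_def B_def)
    moreover have "sawtooth_sum \<cc> y = sawtooth_sum \<aa> u + sawtooth_sum \<bb> v + (1 / 2 - \<theta>)"
      unfolding \<cc>' sawtooth_sum_list_add[OF zero'' zero'(3) y] sawtooth_sum_list_add[OF zero'(1,2) y]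
      by (simp add: sawtooth_sum_list_scale u_def v_def)
        (simp add: sawtooth_sum_def saw_e)
    ultimately show ?thesis
      using height by (simp add: field_simps)
  qed
  ultimately show "integral_factorial_ratio \<cc>"
    by (simp add: integral_factorial_ratio_iff_sawtooth)
qed

end
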